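(* Full indecomposability is sufficient but not necessary for two-fold irreducibility of nonnegative square matrices. That is: every fully indecomposable nonnegative square matrix is two-fold irreducible, and there exists a nonnegative square matrix that is two-fold irreducible but not fully indecomposable.
   Context: A nonnegative $n\times n$ matrix $A$ is irreducible if for every pair of indices $(i,j)$ there is an integer $m\ge1$ with $[A^m]_{ij}>0$. A nonnegative square matrix $A$ is two-fold irreducible if $A$ and $A^{\top}A$ are both irreducible. An $n\times n$ matrix is partly decomposable if it has a $k\times(n-k)$ zero submatrix (any $k$ rows and any $n-k$ columns) for some $1\le k\le n-1$; equivalently, there are permutation matrices $P,Q$ such that $PAQ$ is block triangular with a $k\times(n-k)$ zero block. It is fully indecomposable if it is not partly decomposable; a $1\times1$ matrix is fully indecomposable exactly when it is nonzero. *)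

theory Defs
  imports "Jordan_Normal_Form.Matrix"
begin

definition nonneg_mat :: "real mat \<Rightarrow> bool" where
  "nonneg_mat A \<longleftrightarrow> (\<forall>i<dim_row A. \<forall>j<dim_col A. 0 \<le> A $$ (i, j))"

definition irreducible_mat :: "real mat \<Rightarrow> bool" where
  "irreducible_mat A \<longleftrightarrow> square_mat A \<and>
     (\<forall>i<dim_row A. \<forall>j<dim_row A. \<exists>m\<ge>1. 0 < (A ^\<^sub>m m) $$ (i, j))"

definition two_fold_irreducible :: "real mat \<Rightarrow> bool" where
  "two_fold_irreducible A \<longleftrightarrow> irreducible_mat A \<and> irreducible_mat (A\<^sup>T * A)"

definition partly_decomposable :: "real mat \<Rightarrow> bool" where
  "partly_decomposable A \<longleftrightarrow> square_mat A \<and>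
     (\<exists>k I J. 1 \<le> k \<and> k \<le> dim_row A - 1 \<and>
        I \<subseteq> {..<dim_row A} \<and> card I = k \<and>
        J \<subseteq> {..<dim_row A} \<and> card J = dim_row A - k \<and>
        (\<forall>i\<in>I. \<forall>j\<in>J. A $$ (i, j) = 0))"

(* For size 1 no k is admissible, so partial decomposability says nothing there
   and the zero matrix of size 1 has to be excluded separately. *)
definition fully_indecomposable :: "real mat \<Rightarrow> bool" where
  "fully_indecomposable A \<longleftrightarrow> square_mat A \<and>
     (if dim_row A = 1 then A $$ (0, 0) \<noteq> 0 else \<not> partly_decomposable A)"

end

(* If every cut {1..n} = S + T is crossed by a positive entry in S x T and every row is nonzero, the
   set of indices reachable from a given index is nonempty and closed, hence everything. Full
   indecomposability gives the cut condition for A because |S| + |T| = n. For A^T A, the absence of a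
   crossing entry says that no row of A is nonzero on both S and T; the rows vanishing on S and the
   remaining rows, which vanish on T, then give two zero blocks, one of which is large enough to be
   excluded. The matrix with rows (1, 1) and (1, 0) shows that the converse fails. *)
theory Submission
  imports Defs
begin

lemma nonneg_mat_mult:
  assumes "nonneg_mat A" "nonneg_mat B" "A \<in> carrier_mat n m" "B \<in> carrier_mat m p"
  shows "nonneg_mat (A * B)"
  using assms by (auto simp: nonneg_mat_def scalar_prod_def intro!: sum_nonneg)

lemma nonneg_mat_transpose: "nonneg_mat A \<Longrightarrow> nonneg_mat A\<^sup>T"
  by (auto simp: nonneg_mat_def)

lemma nonneg_mat_pow:
  assumes "nonneg_mat A" "A \<in> carrier_mat n n"
  shows "nonneg_mat (A ^\<^sub>m k)"
proof (induction k)
  case 0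
  show ?case by (auto simp: nonneg_mat_def)
next
  case (Suc k)
  with assms show ?case
    by (auto intro: nonneg_mat_mult pow_carrier_mat)
qed

text \<open>The term of the sum at the intermediate index \<open>j\<close> is positive, and by
  nonnegativity no other term can cancel it.\<close>

lemma nonneg_mat_mult_pos:
  assumes "nonneg_mat A" "nonneg_mat B" "A \<in> carrier_mat n m" "B \<in> carrier_mat m p"
    and "i < n" "j < m" "k < p" "0 < A $$ (i, j)" "0 < B $$ (j, k)"
  shows "0 < (A * B) $$ (i, k)"
proof -
  have "0 < (\<Sum>l\<in>{0..<m}. A $$ (i, l) * B $$ (l, k))"
    using assms by (intro sum_pos2[where i = j]) (auto simp: nonneg_mat_def)
  then show ?thesis
    using assms by (simp add: scalar_prod_def)
qed

text \<open>Walks must have length at least one, so an index does not reach itself for free: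
  \<open>row\<close> supplies the first step. For \<open>n = 1\<close> there are no cuts and
  \<open>row\<close> alone excludes the zero matrix.\<close>

lemma irreducible_matI_cut:
  assumes A: "A \<in> carrier_mat n n" "nonneg_mat A"
    and row: "\<And>i. i < n \<Longrightarrow> \<exists>j<n. 0 < A $$ (i, j)"
    and cut: "\<And>S. S \<subset> {..<n} \<Longrightarrow> S \<noteq> {} \<Longrightarrow> \<exists>i\<in>S. \<exists>j\<in>{..<n} - S. 0 < A $$ (i, j)"
  shows "irreducible_mat A"
proof -
  have "\<exists>m\<ge>1. 0 < (A ^\<^sub>m m) $$ (i, j)" if i: "i < n" and j: "j < n" for i j
  proof -
    define R where "R = {j. j < n \<and> (\<exists>m\<ge>1. 0 < (A ^\<^sub>m m) $$ (i, j))}"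
    have closed: "l \<in> R" if k: "k \<in> R" and l: "l < n" "0 < A $$ (k, l)" for k l
    proof -
      obtain m where "m \<ge> 1" "0 < (A ^\<^sub>m m) $$ (i, k)" "k < n"
        using k by (auto simp: R_def)
      then have "0 < (A ^\<^sub>m Suc m) $$ (i, l)"
        using A i l nonneg_mat_mult_pos[of "A ^\<^sub>m m" A n n n i k l] nonneg_mat_pow[of A n m]
        by auto
      with l show ?thesis
        unfolding R_def by (intro CollectI conjI exI[of _ "Suc m"]) auto
    qed
    obtain l where "l < n" "0 < A $$ (i, l)"
      using row i by blast
    then have "l \<in> R"
      using A unfolding R_def by (intro CollectI conjI exI[of _ 1]) auto
    moreover have "R \<subseteq> {..<n}"
      by (auto simp: R_def)
    \<comment> \<open>If \<open>R\<close> were proper, \<open>cut\<close> would give a positive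
      entry leading out of it, against \<open>closed\<close>.\<close>
    ultimately have "R = {..<n}"
      using cut[of R] closed by blast
    with j show ?thesis
      by (auto simp: R_def)
  qed
  with A show ?thesis
    by (auto simp: irreducible_mat_def)
qed

text \<open>A zero block on \<open>I\<close> and \<open>J\<close> could be shrunk to one of size k
  times n - k, which full indecomposability forbids; nonnegativity turns nonzero into
  positive.\<close>

lemma fully_indecomposable_pos_entry:
  assumes A: "A \<in> carrier_mat n n" "nonneg_mat A" "fully_indecomposable A"
    and I: "I \<subseteq> {..<n}" "I \<noteq> {}" and J: "J \<subseteq> {..<n}" "J \<noteq> {}"
    and card: "n \<le> card I + card J"
  shows "\<exists>i\<in>I. \<exists>j\<in>J. 0 < A $$ (i, j)"
proof (rule ccontr)
  assume *: "\<not> ?thesis"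
  have zero: "A $$ (i, j) = 0" if "i \<in> I" "j \<in> J" for i j
  proof -
    have "0 \<le> A $$ (i, j)"
      using A I J that by (auto simp: nonneg_mat_def)
    with * that show ?thesis by force
  qed
  have fin: "finite I" "finite J"
    using I J finite_subset by blast+
  show False
  proof (cases "n = 1")
    case True
    then have "I = {0}" "J = {0}"
      using I J by auto
    with zero True A show False
      by (auto simp: fully_indecomposable_def)
  next
    case False
    \<comment> \<open>The cap at \<open>n - 1\<close> matters when \<open>I\<close> contains all
      rows: then \<open>n - k = 1\<close>, and one column of the nonempty \<open>J\<close>
      suffices.\<close>
    define k where "k = min (card I) (n - 1)"
    have pos: "card I > 0" "card J > 0" and le: "card I \<le> n"
      using I J fin card_mono[of "{..<n}" I] by (auto simp: card_gt_0_iff)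
    from pos le False have k: "1 \<le> k" "k \<le> n - 1" "k \<le> card I" "n - k \<le> card J"
      using card unfolding k_def by auto
    obtain I' where I': "I' \<subseteq> I" "card I' = k"
      using k(3) by (metis obtain_subset_with_card_n)
    obtain J' where J': "J' \<subseteq> J" "card J' = n - k"
      using k(4) by (metis obtain_subset_with_card_n)
    have "I' \<subseteq> {..<n}" "J' \<subseteq> {..<n}" "\<forall>i\<in>I'. \<forall>j\<in>J'. A $$ (i, j) = 0"
      using I'(1) J'(1) I J zero by blast+
    moreover have "dim_row A = n" "square_mat A"
      using A by auto
    ultimately have "partly_decomposable A"
      unfolding partly_decomposable_def using k(1,2) I'(2) J'(2) by metis
    with A False show False
      by (auto simp: fully_indecomposable_def)
  qed
qed

lemma fully_indecomposable_irreducible: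
  assumes A: "A \<in> carrier_mat n n" "nonneg_mat A" "fully_indecomposable A"
  shows "irreducible_mat A"
proof (rule irreducible_matI_cut[OF A(1,2)])
  show "\<exists>j<n. 0 < A $$ (i, j)" if "i < n" for i
    using fully_indecomposable_pos_entry[OF A, of "{i}" "{..<n}"] that by auto
next
  fix S assume "S \<subset> {..<n}" "S \<noteq> {}"
  then show "\<exists>i\<in>S. \<exists>j\<in>{..<n} - S. 0 < A $$ (i, j)"
    by (intro fully_indecomposable_pos_entry[OF A])
      (auto simp: card_Diff_subset finite_subset[of S "{..<n}"])
qed

lemma fully_indecomposable_irreducible_gram:
  assumes A: "A \<in> carrier_mat n n" "nonneg_mat A" "fully_indecomposable A"
  shows "irreducible_mat (A\<^sup>T * A)"
proof (rule irreducible_matI_cut)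
  show "A\<^sup>T * A \<in> carrier_mat n n" "nonneg_mat (A\<^sup>T * A)"
    using A by (auto intro: nonneg_mat_mult nonneg_mat_transpose)
next
  \<comment> \<open>The entry is the inner product of columns \<open>j\<close> and \<open>k\<close>
    of \<open>A\<close>, so one row positive in both columns is enough.\<close>
  have pos: "0 < (A\<^sup>T * A) $$ (j, k)"
    if "i < n" "j < n" "k < n" "0 < A $$ (i, j)" "0 < A $$ (i, k)" for i j k
    using A that by (intro nonneg_mat_mult_pos[where j = i]) (auto intro: nonneg_mat_transpose)
  {
    fix j assume "j < n"
    \<comment> \<open>Column \<open>j\<close> is nonzero, so the diagonal entry at \<open>j\<close>
      of the Gram matrix is positive and \<open>k = j\<close> works.\<close>
    moreover from this obtain i where "i < n" "0 < A $$ (i, j)"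
      using fully_indecomposable_pos_entry[OF A, of "{..<n}" "{j}"] by auto
    ultimately show "\<exists>k<n. 0 < (A\<^sup>T * A) $$ (j, k)"
      using pos by blast
  next
    fix S assume S: "S \<subset> {..<n}" "S \<noteq> {}"
    define T where "T = {..<n} - S"
    define I where "I = {i. i < n \<and> (\<forall>j\<in>S. \<not> 0 < A $$ (i, j))}"
    have fin: "finite S" "finite I" "I \<subseteq> {..<n}"
      using S finite_subset by (auto simp: I_def)
    have card_T: "card T = n - card S" and card_I: "card ({..<n} - I) = n - card I"
      using S fin by (auto simp: T_def card_Diff_subset)
    have card_S: "card S < n" "0 < card S"
      using psubset_card_mono[of "{..<n}" S] S fin by (auto simp: card_gt_0_iff)
    \<comment> \<open>A row outside \<open>I\<close> is positive somewhere on \<open>S\<close>; if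
      it is positive on \<open>T\<close> as well, \<open>pos\<close> gives the crossing
      entry.\<close>
    have "\<exists>i\<in>{..<n} - I. \<exists>k\<in>T. 0 < A $$ (i, k)"
    proof (rule fully_indecomposable_pos_entry[OF A])
      have "card I + card S < n"
      proof (rule ccontr)
        assume "\<not> card I + card S < n"
        moreover from this have "I \<noteq> {}"
          using card_S by auto
        ultimately have "\<exists>i\<in>I. \<exists>j\<in>S. 0 < A $$ (i, j)"
          using S fin by (intro fully_indecomposable_pos_entry[OF A]) auto
        then show False
          by (auto simp: I_def)
      qed
      \<comment> \<open>The two cardinalities add up to 2n - (\<open>card I + card S\<close>), which
        exceeds n.\<close>
      then show "n \<le> card ({..<n} - I) + card T" "{..<n} - I \<noteq> {}"
        using card_T card_I by (linarith, force)
    qed (use S in \<open>auto simp: T_def\<close>)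
    then obtain i j k where "i < n" "j \<in> S" "0 < A $$ (i, j)" "k \<in> T" "0 < A $$ (i, k)"
      by (auto simp: I_def)
    with pos[of i j k] S show "\<exists>j\<in>S. \<exists>k\<in>{..<n} - S. 0 < (A\<^sup>T * A) $$ (j, k)"
      unfolding T_def by blast
  }
qed

lemma two_fold_irreducible_not_fully_indecomposable:
  fixes A :: "real mat"
  defines "A \<equiv> mat 2 2 (\<lambda>(i, j). if i = 1 \<and> j = 1 then 0 else 1)"
  shows "two_fold_irreducible A" "\<not> fully_indecomposable A"
proof -
  \<comment> \<open>The square has rows (2, 1) and (1, 1). As \<open>A\<close> is symmetric, it is
    also the Gram matrix, so it settles \<open>A\<close> with exponent 2 and the Gram matrix with
    exponent 1.\<close>
  have pos: "0 < (A * A) $$ (i, j)" if "i < 2" "j < 2" for i j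
    using that by (auto simp: A_def scalar_prod_def numeral_2_eq_2 less_Suc_eq)
  have transp: "A\<^sup>T = A"
    by (auto simp: A_def)
  have A: "A \<in> carrier_mat 2 2"
    by (simp add: A_def)
  then have pow: "A ^\<^sub>m 2 = A * A" "(A * A) ^\<^sub>m 1 = A * A"
    by (auto simp: numeral_2_eq_2)
  have "0 < (A ^\<^sub>m 2) $$ (i, j)" "0 < ((A * A) ^\<^sub>m 1) $$ (i, j)" if "i < 2" "j < 2" for i j
    using pos[OF that] unfolding pow by blast+
  moreover have "(1::nat) \<le> 2"
    by simp
  moreover have "dim_row A = 2" "dim_row (A * A) = 2" "square_mat A" "square_mat (A * A)"
    using A by auto
  ultimately have "irreducible_mat A" "irreducible_mat (A * A)"
    unfolding irreducible_mat_def by (metis, metis order_refl)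
  then show "two_fold_irreducible A"
    by (simp add: two_fold_irreducible_def transp)
  \<comment> \<open>The single zero entry is a block with k = n - k = 1.\<close>
  have "partly_decomposable A"
    unfolding partly_decomposable_def
    by (intro conjI exI[of _ 1] exI[of _ "{1}"]) (auto simp: A_def)
  with A show "\<not> fully_indecomposable A"
    by (auto simp: fully_indecomposable_def)
qed

theorem proposition19:
  shows "(\<forall>n (A :: real mat). n \<ge> 1 \<longrightarrow> A \<in> carrier_mat n n \<longrightarrow> nonneg_mat A \<longrightarrow>
            fully_indecomposable A \<longrightarrow> two_fold_irreducible A) \<and>
         (\<exists>n (A :: real mat). n \<ge> 1 \<and> A \<in> carrier_mat n n \<and> nonneg_mat A \<and>
            two_fold_irreducible A \<and> \<not> fully_indecomposable A)"
proof (rule conjI)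
  show "\<forall>n (A :: real mat). n \<ge> 1 \<longrightarrow> A \<in> carrier_mat n n \<longrightarrow> nonneg_mat A \<longrightarrow>
            fully_indecomposable A \<longrightarrow> two_fold_irreducible A"
    using fully_indecomposable_irreducible fully_indecomposable_irreducible_gram
    by (auto simp: two_fold_irreducible_def)
  show "\<exists>n (A :: real mat). n \<ge> 1 \<and> A \<in> carrier_mat n n \<and> nonneg_mat A \<and>
            two_fold_irreducible A \<and> \<not> fully_indecomposable A"
    using two_fold_irreducible_not_fully_indecomposable
    by (intro exI[of _ 2] exI[of _ "mat 2 2 (\<lambda>(i, j). if i = 1 \<and> j = 1 then 0 else 1)"])
      (auto simp: nonneg_mat_def)
qed

end
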